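(* Let $1\le k\le d\le n-1$ and consider a distributed storage system $\mathcal{D}(n,k,d)$ equipped with an MBR product-matrix code over $\mathbb{F}_q$ whose $n\times d$ encoding matrix $\Psi$ is a Cauchy matrix. Then for every $\ell$ with $1\le\ell<k$ the code is $(k-\ell)$-block secure against an adversary of strength $\ell$.
   Context: $\mathbb{F}_q$ is the finite field with $q$ elements and $[n]=\{1,\dots,n\}$. The file size is $\mathcal{M}=kd-\binom{k}{2}=\binom{k+1}{2}+k(d-k)$. File: $\boldsymbol{F}=(F_1,\dots,F_{\mathcal{M}})$ with $F_i$ independent and uniformly distributed over $\mathbb{F}_q$; the stored file $\boldsymbol{f}=(f_1,\dots,f_{\mathcal{M}})$ is a realization of $\boldsymbol{F}$, and each $f_i$ is a data unit. The system has $n$ nodes, and the file is recoverable from any $k$ of them. Product-matrix code: the message matrix is the $d\times d$ symmetric matrix $$\boldsymbol{M}=\begin{pmatrix}\boldsymbol{S}&\boldsymbol{T}\\ \boldsymbol{T}^{\mathrm t}&\boldsymbol{0}\end{pmatrix},$$ where $\boldsymbol{S}$ is a $k\times k$ symmetric matrix whose $\binom{k+1}{2}$ upper-triangular entries (including the diagonal) are distinct data units, and $\boldsymbol{T}$ is a $k\times(d-k)$ matrix whose entries are the remaining $k(d-k)$ data units. The encoding matrix is an $n\times d$ matrix $\Psi=[\Phi\ \ \Delta]$ over $\mathbb{F}_q$ with $\Phi$ of size $n\times k$ and $\Delta$ of size $n\times(d-k)$, such that any $d$ rows of $\Psi$ are linearly independent and any $k$ rows of $\Phi$ are linearly independent.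 Node $i$ stores the $d$ entries of row $i$ of $\Psi\boldsymbol{M}$. Cauchy matrix: a matrix of the form $\big((x_i+y_j)^{-1}\big)$ with $x_i,y_j\in\mathbb{F}_q$, $x_i+y_j\neq0$ for all $i,j$, the $x_i$ pairwise distinct and the $y_j$ pairwise distinct. Block security: let $\boldsymbol{C}^i$ be the random vector giving the content stored at Node $i$ when the file is $\boldsymbol{F}$. For $\ell<k$, the system is $b$-block secure against an adversary of strength $\ell$ if $\mathsf{I}\big((F_j)_{j\in B};(\boldsymbol{C}^i)_{i\in E}\big)=0$ (mutual information) for all $B\subseteq[\mathcal{M}]$ with $|B|\le b$ and all $E\subseteq[n]$ with $|E|\le\ell$. *)

theory Defs
  imports "HOL-Probability.Information" "Jordan_Normal_Form.VS_Connect"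
begin

text \<open>
  Indices are zero-based, as in \<^theory>\<open>Jordan_Normal_Form.Matrix\<close>: nodes are \<open>{..<n}\<close> and
  data units are \<open>{..<file_size k d}\<close>. The field with \<open>q\<close> elements is a type of
  class \<open>{field, finite}\<close>.
\<close>

section \<open>Encoding matrices\<close>

definition cauchy_mat :: "'a::field mat \<Rightarrow> bool" where
  "cauchy_mat A \<longleftrightarrow>
     (\<exists>x y. inj_on x {..<dim_row A} \<and> inj_on y {..<dim_col A} \<and>
        (\<forall>i<dim_row A. \<forall>j<dim_col A. x i + y j \<noteq> 0 \<and> A $$ (i, j) = inverse (x i + y j)))"

text \<open>Linear dependence is a property of sets of vectors; injectivity of \<^term>\<open>row A\<close>
  on the index set excludes repeated rows.\<close>

definition any_rows_lin_indpt :: "nat \<Rightarrow> 'a::field mat \<Rightarrow> bool" where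
  "any_rows_lin_indpt r A \<longleftrightarrow>
     (\<forall>I\<subseteq>{..<dim_row A}. card I = r \<longrightarrow>
        inj_on (row A) I \<and>
        \<not> module.lin_dep class_ring (module_vec TYPE('a) (dim_col A)) (row A ` I))"

definition pm_encoding_mat :: "nat \<Rightarrow> nat \<Rightarrow> nat \<Rightarrow> 'a::field mat \<Rightarrow> bool" where
  "pm_encoding_mat n k d \<Psi> \<longleftrightarrow>
     \<Psi> \<in> carrier_mat n d \<and>
     any_rows_lin_indpt d \<Psi> \<and>
     any_rows_lin_indpt k (mat n k (\<lambda>(i, j). \<Psi> $$ (i, j)))"

section \<open>Message matrices\<close>

definition file_size :: "nat \<Rightarrow> nat \<Rightarrow> nat" where
  "file_size k d = k * d - (k choose 2)"

text \<open>A layout assigns to each free position of the message matrix, i.e. the upper triangle of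
  \<open>S\<close> (columns below \<open>k\<close>) and all of \<open>T\<close> (columns \<open>k, \<dots>, d - 1\<close>), the index of the data unit
  placed there. Every data unit is used exactly once.\<close>

definition unit_layout :: "nat \<Rightarrow> nat \<Rightarrow> (nat \<times> nat \<Rightarrow> nat) \<Rightarrow> bool" where
  "unit_layout k d \<sigma> \<longleftrightarrow>
     bij_betw \<sigma> {(i, j). i < k \<and> i \<le> j \<and> j < d} {..<file_size k d}"

definition message_mat ::
    "nat \<Rightarrow> nat \<Rightarrow> (nat \<times> nat \<Rightarrow> nat) \<Rightarrow> (nat \<Rightarrow> 'a::field) \<Rightarrow> 'a mat" where
  "message_mat k d \<sigma> f =
     (let S = mat k k (\<lambda>(i, j). f (\<sigma> (min i j, max i j)));
          T = mat k (d - k) (\<lambda>(i, j). f (\<sigma> (i, k + j)))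
      in four_block_mat S T T\<^sup>T (0\<^sub>m (d - k) (d - k)))"

definition node_content ::
    "nat \<Rightarrow> nat \<Rightarrow> 'a::field mat \<Rightarrow> (nat \<times> nat \<Rightarrow> nat) \<Rightarrow> (nat \<Rightarrow> 'a) \<Rightarrow> nat \<Rightarrow> 'a vec" where
  "node_content k d \<Psi> \<sigma> f i = row (\<Psi> * message_mat k d \<sigma> f) i"

section \<open>Random files and block security\<close>

definition (in prob_space) uniform_file :: "nat \<Rightarrow> (nat \<Rightarrow> 'a \<Rightarrow> 'q::finite) \<Rightarrow> bool" where
  "uniform_file m F \<longleftrightarrow>
     indep_vars (\<lambda>_. count_space UNIV) F {..<m} \<and>
     (\<forall>j<m. distr M (count_space UNIV) (F j) = uniform_count_measure UNIV)"

text \<open>\<open>m\<close> is the number of data units, \<open>n\<close> the number of nodes, \<open>C i\<close> the random content of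
  node \<open>i\<close>, \<open>s\<close> the block size and \<open>l\<close> the strength of the adversary. The locale parameter
  \<^term>\<open>b\<close> is the base of the logarithm.\<close>

definition (in information_space) block_secure ::
    "nat \<Rightarrow> nat \<Rightarrow> (nat \<Rightarrow> 'a \<Rightarrow> 'x) \<Rightarrow> (nat \<Rightarrow> 'a \<Rightarrow> 'y) \<Rightarrow> nat \<Rightarrow> nat \<Rightarrow> bool" where
  "block_secure m n F C s l \<longleftrightarrow>
     (\<forall>B\<subseteq>{..<m}. \<forall>E\<subseteq>{..<n}. card B \<le> s \<longrightarrow> card E \<le> l \<longrightarrow>
        \<I>((\<lambda>\<omega>. \<lambda>j\<in>B. F j \<omega>) ; (\<lambda>\<omega>. \<lambda>i\<in>E. C i \<omega>)) = 0)"

end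

theory Submission
  imports Defs
begin

text \<open>
  For a Cauchy matrix \<open>\<Psi>\<close>, every choice of \<open>l + 1\<close> columns carries a vector with exactly this
  support that is orthogonal to the \<open>l\<close> rows seen by the adversary. Symmetrized products of two such
  vectors are message matrices that the adversary reads as zero, and choosing the supports suitably
  isolates any one of \<open>k - l\<close> given entries. Hence any values on a block of \<open>k - l\<close> data units are
  attained by a file with zero observed content. Translating by such files shows that the joint
  probability of a block value and an observation does not depend on the block value.
\<close>

section \<open>Kernel vectors of Cauchy matrices\<close>

text \<open>The sum is a divided difference: the coefficient of degree \<open>card J - 1\<close> in
  the Lagrange interpolant of \<open>p\<close> at the nodes \<open>y j\<close>. The interpolant is
  \<open>p\<close> itself, whose degree is too small for that coefficient to be nonzero.\<close>

lemma sum_poly_div_prod_diff_eq_0: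
  fixes y :: "'b \<Rightarrow> 'a::field"
  assumes J: "finite J" "inj_on y J" and p: "degree p + 1 < card J"
  shows "(\<Sum>j\<in>J. poly p (y j) / (\<Prod>i\<in>J - {j}. y j - y i)) = 0"
proof -
  \<comment> \<open>\<open>R j\<close> is the monic numerator of the Lagrange basis polynomial at
    node \<open>y j\<close>, \<open>D j\<close> is its value there, and \<open>L\<close> is the
    interpolant of \<open>p\<close>.\<close>
  define R where "R j = (\<Prod>i\<in>J - {j}. [:- y i, 1:])" for j
  define D where "D j = (\<Prod>i\<in>J - {j}. y j - y i)" for j
  define L where "L = (\<Sum>j\<in>J. Polynomial.smult (poly p (y j) / D j) (R j))"
  have degR: "degree (R j) = card J - 1" if "j \<in> J" for j
    using that J unfolding R_def by (subst degree_prod_sum_eq) auto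
  have coeffR: "coeff (R j) (card J - 1) = 1" if "j \<in> J" for j
    using lead_coeff_prod[of "\<lambda>i. [:- y i, 1:]" "J - {j}"] degR[OF that]
    unfolding R_def by simp
  have D0: "D j \<noteq> 0" if "j \<in> J" for j
    using that J unfolding D_def by (auto simp: inj_on_def)
  have Rj: "poly (R i) (y j) = (if i = j then D j else 0)" if "i \<in> J" "j \<in> J" for i j
  proof (cases "i = j")
    case True
    then show ?thesis by (simp add: R_def D_def poly_prod)
  next
    case False
    then have "j \<in> J - {i}" using that by simp
    then show ?thesis using False J(1) by (auto simp: R_def poly_prod)
  qed
  have "degree L \<le> card J - 1"
    unfolding L_def using degR degree_smult_le by (intro degree_sum_le) (auto simp: J)
  have "p = L"
  proof (rule poly_eqI_degree)
    show "poly p x = poly L x" if x: "x \<in> y ` J" for x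
    proof -
      obtain j where j: "j \<in> J" "x = y j" using x by auto
      have "poly L x = (\<Sum>i\<in>J. if i = j then poly p (y j) else 0)"
        unfolding L_def poly_sum using j Rj D0 by (intro sum.cong) auto
      then show ?thesis using j J(1) by simp
    qed
    show "degree p < card (y ` J)" "degree L < card (y ` J)"
      using p \<open>degree L \<le> card J - 1\<close> by (auto simp: card_image J(2))
  qed
  then have "coeff L (card J - 1) = 0"
    using p by (intro coeff_eq_0) simp
  moreover have "coeff L (card J - 1) = (\<Sum>j\<in>J. poly p (y j) / D j)"
    unfolding L_def coeff_sum using coeffR by (intro sum.cong) auto
  ultimately show ?thesis unfolding D_def by simp
qed

text \<open>The witness is \<open>w j = (\<Prod>i\<in>E. x i + y j) / (\<Prod>i\<in>J - {j}. y j - y i)\<close>: pairing it with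
  row \<open>i\<close> cancels the factor \<open>x i + y j\<close> and leaves a divided difference over \<open>J\<close> of a polynomial
  of degree \<open>card E - 1\<close>.\<close>

lemma cauchy_mat_kernel_vector:
  assumes A: "cauchy_mat A" and E: "E \<subseteq> {..<dim_row A}"
    and J: "J \<subseteq> {..<dim_col A}" "card E < card J"
  shows "\<exists>w. (\<forall>j. w j \<noteq> 0 \<longleftrightarrow> j \<in> J) \<and> (\<forall>i\<in>E. (\<Sum>j<dim_col A. A $$ (i, j) * w j) = 0)"
proof -
  from A obtain x y where y: "inj_on y {..<dim_col A}"
    and xy: "\<And>i j. i < dim_row A \<Longrightarrow> j < dim_col A \<Longrightarrow>
      x i + y j \<noteq> 0 \<and> A $$ (i, j) = inverse (x i + y j)"
    unfolding cauchy_mat_def by blast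
  have finJ: "finite J" and finE: "finite E"
    using J E finite_subset by blast+
  have yJ: "inj_on y J" using y J(1) by (rule inj_on_subset)
  define w where "w j = (if j \<in> J
    then (\<Prod>i\<in>E. x i + y j) / (\<Prod>i\<in>J - {j}. y j - y i) else 0)" for j
  have "w j \<noteq> 0" if "j \<in> J" for j
  proof -
    have "j < dim_col A" using J(1) that by auto
    then have "(\<Prod>i\<in>E. x i + y j) \<noteq> 0"
      using xy E finE by (force simp: prod_zero_iff)
    moreover have "(\<Prod>i\<in>J - {j}. y j - y i) \<noteq> 0"
      using yJ that finJ by (auto simp: inj_on_def)
    ultimately show ?thesis using that by (simp add: w_def)
  qed
  then have "\<forall>j. w j \<noteq> 0 \<longleftrightarrow> j \<in> J" by (auto simp: w_def)
  moreover have "(\<Sum>j<dim_col A. A $$ (i, j) * w j) = 0" if i: "i \<in> E" for i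
  proof -
    define p where "p = (\<Prod>i'\<in>E - {i}. [:x i', 1:])"
    have "degree p = card E - 1"
      using i finE unfolding p_def by (subst degree_prod_sum_eq) auto
    \<comment> \<open>Positivity undoes the truncated subtraction: \<open>degree p + 1\<close> is
      exactly \<open>card E\<close>.\<close>
    moreover have "card E > 0" using i finE by (auto simp: card_gt_0_iff)
    ultimately have "degree p + 1 < card J" using J(2) by simp
    note zero = sum_poly_div_prod_diff_eq_0[OF finJ yJ this]
    have "(\<Sum>j<dim_col A. A $$ (i, j) * w j) = (\<Sum>j\<in>J. A $$ (i, j) * w j)"
      using J(1) by (intro sum.mono_neutral_right) (auto simp: w_def)
    also have "\<dots> = (\<Sum>j\<in>J. poly p (y j) / (\<Prod>i\<in>J - {j}. y j - y i))"
    proof (rule sum.cong)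
      fix j assume j: "j \<in> J"
      have *: "x i + y j \<noteq> 0" "A $$ (i, j) = inverse (x i + y j)"
        using xy[of i j] i j E J(1) by auto
      have "(\<Prod>i\<in>E. x i + y j) = (x i + y j) * poly p (y j)"
        using i finE by (simp add: p_def poly_prod prod.remove)
      then show "A $$ (i, j) * w j = poly p (y j) / (\<Prod>i\<in>J - {j}. y j - y i)"
        using * j by (simp add: w_def)
    qed simp
    finally show ?thesis using zero by simp
  qed
  ultimately show ?thesis by blast
qed

section \<open>Message matrices in the kernel\<close>

text \<open>Used to choose supports of kernel vectors: \<open>A\<close> holds the indices where the
  vector must not vanish, \<open>Z\<close> those where it must.\<close>

lemma exists_superset_avoiding:
  assumes "A \<subseteq> {..<m}" "finite Z" "A \<inter> Z = {}" "card A \<le> r" "r + card Z \<le> m"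
  shows "\<exists>J. A \<subseteq> J \<and> J \<subseteq> {..<m::nat} - Z \<and> card J = r"
proof -
  have "card ({..<m} - Z) \<ge> m - card Z"
    using diff_card_le_card_Diff[OF assms(2), of "{..<m}"] by simp
  then have "r \<le> card ({..<m} - Z)" using assms(5) by linarith
  then show ?thesis
    using assms by (intro exists_subset_between) auto
qed

text \<open>A symmetric matrix with zero lower right block whose columns lie in the kernel is built as
  \<open>u u\<^sup>T\<close> or \<open>u w\<^sup>T + w u\<^sup>T\<close>, with \<open>u\<close> supported in the first \<open>k\<close> coordinates and \<open>u\<close>, \<open>w\<close>
  vanishing wherever this is needed to make the entries in \<open>Q\<close> zero. The form \<open>u u\<^sup>T\<close> serves the
  cases where the entry \<open>u a * w b + w a * u b\<close> of the other form could vanish, by characteristic two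
  if \<open>a = b\<close> or by cancellation.\<close>

lemma kernel_symmetric_separating:
  fixes \<Psi> :: "'a::field mat"
  assumes \<Psi>: "cauchy_mat \<Psi>" "dim_col \<Psi> = d" and E: "E \<subseteq> {..<dim_row \<Psi>}" "card E \<le> l"
    and l: "1 \<le> l" and kd: "k \<le> d"
    and ab: "a < k" "a \<le> b" "b < d"
    and Q: "finite Q" "card Q + l < k" "(a, b) \<notin> Q" "\<forall>(i, j)\<in>Q. i \<le> j"
  shows "\<exists>H. (\<forall>r c. H r c = H c r) \<and> (\<forall>r c. k \<le> r \<longrightarrow> k \<le> c \<longrightarrow> H r c = 0) \<and>
    H a b \<noteq> 0 \<and> (\<forall>(i, j)\<in>Q. H i j = 0) \<and>
    (\<forall>i\<in>E. \<forall>c. (\<Sum>r<d. \<Psi> $$ (i, r) * H r c) = (0::'a))"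
proof -
  \<comment> \<open>At an index of \<open>q\<close> outside \<open>{a, b}\<close>, both
    \<open>u\<close> and \<open>w\<close> may vanish without affecting the entry at
    \<open>(a, b)\<close>, and this alone makes the entry at \<open>q\<close> zero.\<close>
  define third where "third q z \<longleftrightarrow> z \<in> {fst q, snd q} \<and> z \<notin> {a, b}" for q z
  \<comment> \<open>The defaults force \<open>u b = 0\<close> and \<open>w a = 0\<close>, which
    clears the diagonal positions \<open>(b, b)\<close> and \<open>(a, a)\<close>.\<close>
  define u_kill where "u_kill q = (if \<exists>z. third q z then SOME z. third q z else b)" for q :: "nat \<times> nat"
  define w_kill where "w_kill q = (if \<exists>z. third q z then SOME z. third q z else a)" for q :: "nat \<times> nat"
  have kill: "third q (u_kill q) \<and> w_kill q = u_kill q" if "\<exists>z. third q z" for q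
    using that by (auto simp: u_kill_def w_kill_def intro: someI)
  \<comment> \<open>Among positions with both coordinates in \<open>{a, b}\<close>,
    \<open>(a, b)\<close> is not in \<open>Q\<close> and the ordering rules out
    \<open>(b, a)\<close>, so only diagonal ones different from \<open>(a, b)\<close>
    remain.\<close>
  have no_third: "(q = (a, a) \<or> q = (b, b)) \<and> a \<noteq> b" if "q \<in> Q" "\<nexists>z. third q z" for q
  proof -
    obtain i j where q: "q = (i, j)" by (cases q)
    have "i \<in> {a, b}" "j \<in> {a, b}" using that(2) q unfolding third_def by auto
    moreover have "i \<le> j" "(i, j) \<noteq> (a, b)" using that(1) q Q(3,4) by auto
    ultimately show ?thesis using q ab(2) by auto
  qed
  have kernel: "\<exists>w. (\<forall>j. w j \<noteq> 0 \<longleftrightarrow> j \<in> J) \<and> (\<forall>i\<in>E. (\<Sum>j<d. \<Psi> $$ (i, j) * w j) = 0)"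
    if "J \<subseteq> {..<d}" "card J = l + 1" for J
    using cauchy_mat_kernel_vector[OF \<Psi>(1) E(1), of J] that \<Psi>(2) E(2) by auto
  have scale: "(\<Sum>j<d. \<Psi> $$ (i, j) * (u j * v c)) = (\<Sum>j<d. \<Psi> $$ (i, j) * u j) * v c" for u v i and c :: nat
    by (simp add: sum_distrib_right mult.assoc)
  \<comment> \<open>Each position in \<open>Q\<close> forbids at most one index per vector, so at
    least \<open>l + 1\<close> of the first \<open>k\<close> indices stay available.\<close>
  have card_kill: "card (f ` Q) + l < k" for f :: "nat \<times> nat \<Rightarrow> nat"
    using card_image_le[OF Q(1), of f] Q(2) by linarith
  show ?thesis
  proof (cases "b < k \<and> (\<forall>q\<in>Q. \<exists>z. third q z)")
    case True
    then have "{a, b} \<inter> u_kill ` Q = {}" using kill unfolding third_def by fastforce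
    \<comment> \<open>A support of size \<open>l + 1\<close> has room for both indices because
      \<open>1 \<le> l\<close>.\<close>
    moreover have "card {a, b} \<le> l + 1" using l card_insert_le_m1[of 2 "{b}" a] by simp
    ultimately obtain J where J: "{a, b} \<subseteq> J" "J \<subseteq> {..<k} - u_kill ` Q" "card J = l + 1"
      using exists_superset_avoiding[of "{a, b}" k "u_kill ` Q" "l + 1"] card_kill[of u_kill] ab True Q(1)
      by auto
    obtain u where u: "\<And>j. u j \<noteq> 0 \<longleftrightarrow> j \<in> J" "\<forall>i\<in>E. (\<Sum>j<d. \<Psi> $$ (i, j) * u j) = 0"
      using kernel[of J] J kd by force
    have u0: "u j = 0" if "j \<notin> J" for j using u(1) that by blast
    have "u i * u j = 0" if "(i, j) \<in> Q" for i j
    proof -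
      have "third (i, j) (u_kill (i, j))" using kill True that by blast
      then have "u_kill (i, j) \<in> {i, j}" by (simp add: third_def)
      moreover have "u_kill (i, j) \<notin> J" using that J(2) by blast
      ultimately show ?thesis using u0 by auto
    qed
    moreover have "u a * u b \<noteq> 0" using u(1) J(1) by simp
    moreover have "u r = 0" if "k \<le> r" for r
      using that J(2) by (intro u0) (auto simp: subset_iff)
    moreover have "(\<Sum>r<d. \<Psi> $$ (i, r) * (u r * u c)) = 0" if "i \<in> E" for i c
      using u(2) that by (simp add: scale)
    ultimately show ?thesis
      by (intro exI[of _ "\<lambda>r c. u r * u c"]) (auto simp: mult.commute)
  next
    case False
    have "a \<notin> u_kill ` Q" "b \<notin> w_kill ` Q"
    proof -
      have "a \<noteq> u_kill q \<and> b \<noteq> w_kill q" if "q \<in> Q" for q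
      proof (cases "\<exists>z. third q z")
        case True
        from kill[OF True] show ?thesis by (auto simp: third_def)
      next
        case none: False
        then show ?thesis using no_third[OF that none] by (simp add: u_kill_def w_kill_def)
      qed
      then show "a \<notin> u_kill ` Q" "b \<notin> w_kill ` Q" by blast+
    qed
    \<comment> \<open>Keeping \<open>J\<close> below \<open>k\<close> makes the lower right block
      vanish, while \<open>K\<close> may extend up to \<open>d\<close>, since \<open>b\<close> may
      lie beyond \<open>k\<close>.\<close>
    then obtain J K where J: "a \<in> J" "J \<subseteq> {..<k} - u_kill ` Q" "card J = l + 1"
      and K: "b \<in> K" "K \<subseteq> {..<d} - w_kill ` Q" "card K = l + 1"
      using exists_superset_avoiding[of "{a}" k "u_kill ` Q" "l + 1"] card_kill[of u_kill]
        exists_superset_avoiding[of "{b}" d "w_kill ` Q" "l + 1"] card_kill[of w_kill] ab kd Q(1)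
      by auto
    obtain u where u: "\<And>j. u j \<noteq> 0 \<longleftrightarrow> j \<in> J" "\<forall>i\<in>E. (\<Sum>j<d. \<Psi> $$ (i, j) * u j) = 0"
      using kernel[of J] J kd by force
    obtain w where w: "\<And>j. w j \<noteq> 0 \<longleftrightarrow> j \<in> K" "\<forall>i\<in>E. (\<Sum>j<d. \<Psi> $$ (i, j) * w j) = 0"
      using kernel[of K] K by force
    have u0: "u j = 0" if "j \<notin> J" for j using u(1) that by blast
    have w0: "w j = 0" if "j \<notin> K" for j using w(1) that by blast
    have kills: "u (u_kill q) = 0 \<and> w (w_kill q) = 0" if "q \<in> Q" for q
      using that J(2) K(2) by (intro conjI u0 w0) auto
    have zero: "u i * w j + w i * u j = 0" if q: "(i, j) \<in> Q" for i j
    proof (cases "\<exists>z. third (i, j) z")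
      case True
      from kill[OF this] have "u_kill (i, j) \<in> {i, j}" "w_kill (i, j) = u_kill (i, j)"
        by (auto simp: third_def)
      then show ?thesis using kills[OF q] by auto
    next
      case none: False
      then have "u b = 0" "w a = 0" using kills[OF q] by (auto simp: u_kill_def w_kill_def)
      then show ?thesis using no_third[OF q none] by auto
    qed
    \<comment> \<open>This removes the cross term \<open>w a * u b\<close>, so nothing can cancel
      \<open>u a * w b\<close>. Either \<open>b\<close> lies outside the first \<open>k\<close>
      indices, or some position in \<open>Q\<close> triggers the default
      \<open>u_kill q = b\<close>.\<close>
    have "u b = 0"
    proof (cases "b < k")
      case True
      then obtain q where "q \<in> Q" "\<nexists>z. third q z" using False by blast
      then show ?thesis using kills[of q] by (auto simp: u_kill_def)
    next
      case False
      then show ?thesis using J(2) by (intro u0) (auto simp: subset_iff)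
    qed
    then have "u a * w b + w a * u b \<noteq> 0" using u(1) w(1) J(1) K(1) by simp
    moreover have "u r = 0" if "k \<le> r" for r
      using that J(2) by (intro u0) (auto simp: subset_iff)
    moreover have "(\<Sum>r<d. \<Psi> $$ (i, r) * (u r * w c + w r * u c)) = 0" if "i \<in> E" for i c
      using u(2) w(2) that by (simp add: distrib_left sum.distrib scale)
    ultimately show ?thesis
      using zero by (intro exI[of _ "\<lambda>r c. u r * w c + w r * u c"]) (auto simp: mult.commute)
  qed
qed

text \<open>All conditions except the prescribed values are linear and homogeneous, so separating
  matrices, one per position \<open>p\<close>, can be scaled and summed as in Lagrange
  interpolation. Removing \<open>p\<close> from \<open>P\<close> turns the bound on
  \<open>card P\<close> into the strict one required of \<open>Q\<close>.\<close>

lemma kernel_symmetric_interpolation: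
  fixes \<Psi> :: "'a::field mat"
  assumes \<Psi>: "cauchy_mat \<Psi>" "dim_col \<Psi> = d" and E: "E \<subseteq> {..<dim_row \<Psi>}" "card E \<le> l"
    and l: "1 \<le> l" and kd: "k \<le> d"
    and P: "P \<subseteq> {(i, j). i < k \<and> i \<le> j \<and> j < d}" "card P + l \<le> k"
  shows "\<exists>H. (\<forall>r c. H r c = H c r) \<and> (\<forall>r c. k \<le> r \<longrightarrow> k \<le> c \<longrightarrow> H r c = 0) \<and>
    (\<forall>(i, j)\<in>P. H i j = \<beta> (i, j)) \<and>
    (\<forall>i\<in>E. \<forall>c. (\<Sum>r<d. \<Psi> $$ (i, r) * H r c) = (0::'a))"
proof -
  have finP: "finite P"
    by (rule finite_subset[of _ "{..<d} \<times> {..<d}"]) (use P(1) kd in auto)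
  have "\<exists>H. (\<forall>r c. H r c = H c r) \<and> (\<forall>r c. k \<le> r \<longrightarrow> k \<le> c \<longrightarrow> H r c = 0) \<and>
    H (fst p) (snd p) \<noteq> 0 \<and> (\<forall>(i, j)\<in>P - {p}. H i j = 0) \<and>
    (\<forall>i\<in>E. \<forall>c. (\<Sum>r<d. \<Psi> $$ (i, r) * H r c) = 0)" (is "\<exists>H. ?sep H p") if p: "p \<in> P" for p
  proof (rule kernel_symmetric_separating[OF \<Psi> E l kd])
    show "card (P - {p}) + l < k"
      using P(2) card_Diff1_less[OF finP p] by linarith
  qed (use p P(1) finP in auto)
  then have "\<forall>p\<in>P. \<exists>H. ?sep H p" by blast
  then obtain H where sep: "\<forall>p\<in>P. ?sep (H p) p" unfolding bchoice_iff by blast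
  have H: "\<And>p r c. p \<in> P \<Longrightarrow> H p r c = H p c r"
      "\<And>p r c. p \<in> P \<Longrightarrow> k \<le> r \<Longrightarrow> k \<le> c \<Longrightarrow> H p r c = 0"
      "\<And>p. p \<in> P \<Longrightarrow> H p (fst p) (snd p) \<noteq> 0"
      "\<And>p i j. p \<in> P \<Longrightarrow> (i, j) \<in> P \<Longrightarrow> (i, j) \<noteq> p \<Longrightarrow> H p i j = 0"
      "\<And>p i c. p \<in> P \<Longrightarrow> i \<in> E \<Longrightarrow> (\<Sum>r<d. \<Psi> $$ (i, r) * H p r c) = 0"
    using sep by blast+
  define s where "s p = \<beta> p / H p (fst p) (snd p)" for p
  define G where "G r c = (\<Sum>p\<in>P. s p * H p r c)" for r c
  have "G r c = G c r" for r c unfolding G_def using H(1) by (intro sum.cong) auto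
  moreover have "G r c = 0" if "k \<le> r" "k \<le> c" for r c
    unfolding G_def using H(2) that by (intro sum.neutral) auto
  moreover have "G i j = \<beta> (i, j)" if q: "(i, j) \<in> P" for i j
  proof -
    have "G i j = (\<Sum>p\<in>P. if p = (i, j) then \<beta> (i, j) else 0)"
      unfolding G_def using H(3,4) q by (intro sum.cong) (auto simp: s_def)
    then show ?thesis using q finP by simp
  qed
  moreover have "(\<Sum>r<d. \<Psi> $$ (i, r) * G r c) = 0" if i: "i \<in> E" for i c
  proof -
    have "(\<Sum>r<d. \<Psi> $$ (i, r) * G r c) = (\<Sum>p\<in>P. s p * (\<Sum>r<d. \<Psi> $$ (i, r) * H p r c))"
      unfolding G_def sum_distrib_left by (subst sum.swap) (simp add: mult_ac)
    then show ?thesis using H(5) i by simp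
  qed
  ultimately show ?thesis by (intro exI[of _ G]) auto
qed

section \<open>Node contents as additive functions of the file\<close>

lemma node_content_eq:
  assumes "\<Psi> \<in> carrier_mat n d" "k \<le> d" "i < n"
  shows "node_content k d \<Psi> \<sigma> f i = vec d (\<lambda>c. \<Sum>r<d. \<Psi> $$ (i, r) *
    (if r < k \<or> c < k then f (\<sigma> (min r c, max r c)) else 0))"
proof -
  have "message_mat k d \<sigma> f \<in> carrier_mat d d"
    using assms(2) unfolding message_mat_def Let_def by (intro carrier_matI) auto
  moreover have "message_mat k d \<sigma> f $$ (r, c) =
      (if r < k \<or> c < k then f (\<sigma> (min r c, max r c)) else 0)" if "r < d" "c < d" for r c
    using that assms(2) unfolding message_mat_def Let_def
    by (auto simp: min_def max_def)
  ultimately show ?thesis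
    using assms unfolding node_content_def
    by (intro eq_vecI) (auto simp: scalar_prod_def lessThan_atLeast0 intro!: sum.cong)
qed

lemma unit_layout_less:
  assumes "unit_layout k d \<sigma>" "i < k" "i \<le> j" "j < d"
  shows "\<sigma> (i, j) < file_size k d"
  using assms unfolding unit_layout_def bij_betw_def by auto

lemma unit_layout_inv:
  assumes "unit_layout k d \<sigma>" "i < k" "i \<le> j" "j < d"
  shows "inv_into {(i, j). i < k \<and> i \<le> j \<and> j < d} \<sigma> (\<sigma> (i, j)) = (i, j)"
  using assms unfolding unit_layout_def by (intro inv_into_f_f) (auto simp: bij_betw_def)

text \<open>Files are total functions on the naturals; this allows replacing one by its restriction
  to the actual data units.\<close>

lemma node_content_cong:
  assumes "\<Psi> \<in> carrier_mat n d" "k \<le> d" "i < n" "unit_layout k d \<sigma>"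
    and "\<And>j. j < file_size k d \<Longrightarrow> f j = g j"
  shows "node_content k d \<Psi> \<sigma> f i = node_content k d \<Psi> \<sigma> g i"
proof -
  have "f (\<sigma> (min r c, max r c)) = g (\<sigma> (min r c, max r c))" if "r < k \<or> c < k" "r < d" "c < d" for r c
    using that by (intro assms(5) unit_layout_less[OF assms(4)]) auto
  then show ?thesis
    unfolding node_content_eq[OF assms(1-3)] by (intro eq_vecI) (auto intro!: sum.cong)
qed

text \<open>By linearity of the encoding, translation by a file that a node reads as zero is
  invisible to that node.\<close>

lemma node_content_add_null:
  fixes \<Psi> :: "'a::field mat"
  assumes "\<Psi> \<in> carrier_mat n d" "k \<le> d" "i < n"
    and "node_content k d \<Psi> \<sigma> g i = 0\<^sub>v d"
  shows "node_content k d \<Psi> \<sigma> (\<lambda>j. f j + g j) i = node_content k d \<Psi> \<sigma> f i"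
proof (rule eq_vecI)
  note eq = node_content_eq[OF assms(1-3)]
  fix c assume "c < dim_vec (node_content k d \<Psi> \<sigma> f i)"
  then have c: "c < d" by (simp add: eq)
  have "node_content k d \<Psi> \<sigma> (\<lambda>j. f j + g j) i $ c =
      node_content k d \<Psi> \<sigma> f i $ c + node_content k d \<Psi> \<sigma> g i $ c"
    using c unfolding eq
    by (simp add: sum.distrib[symmetric] distrib_left[symmetric])
      (intro sum.cong refl, simp)
  then show "node_content k d \<Psi> \<sigma> (\<lambda>j. f j + g j) i $ c = node_content k d \<Psi> \<sigma> f i $ c"
    using c assms(4) by simp
qed (simp add: node_content_eq[OF assms(1-3)])

text \<open>The interpolating kernel matrix is turned into a file by reading its entries through the
  inverse layout \<open>\<tau>\<close>.\<close>

lemma null_file_interpolation: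
  fixes \<Psi> :: "'a::field mat"
  assumes \<Psi>: "cauchy_mat \<Psi>" "\<Psi> \<in> carrier_mat n d" and kd: "k \<le> d" and \<sigma>: "unit_layout k d \<sigma>"
    and E: "E \<subseteq> {..<n}" "card E \<le> l" and l: "1 \<le> l"
    and B: "B \<subseteq> {..<file_size k d}" "card B + l \<le> k"
  shows "\<exists>g. (\<forall>j\<in>B. g j = f j) \<and> (\<forall>i\<in>E. node_content k d \<Psi> \<sigma> g i = 0\<^sub>v d)"
proof -
  let ?D = "{(i, j). i < k \<and> i \<le> j \<and> j < d}"
  define \<tau> where "\<tau> = inv_into ?D \<sigma>"
  have \<sigma>\<tau>: "\<tau> j \<in> ?D \<and> \<sigma> (\<tau> j) = j" if "j \<in> B" for j
  proof -
    have "j \<in> \<sigma> ` ?D" using \<sigma> B(1) that unfolding unit_layout_def bij_betw_def by auto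
    then show ?thesis
      unfolding \<tau>_def by (intro conjI inv_into_into f_inv_into_f)
  qed
  have finB: "finite B" using B(1) finite_subset by blast
  have "\<tau> ` B \<subseteq> ?D" using \<sigma>\<tau> by (intro image_subsetI) simp
  moreover have "card (\<tau> ` B) + l \<le> k" using card_image_le[OF finB, of \<tau>] B(2) by linarith
  ultimately obtain H where H: "\<forall>r c. H r c = H c r" "\<forall>r c. k \<le> r \<longrightarrow> k \<le> c \<longrightarrow> H r c = 0"
      "\<forall>(i, j)\<in>\<tau> ` B. H i j = (f \<circ> \<sigma>) (i, j)"
      "\<forall>i\<in>E. \<forall>c. (\<Sum>r<d. \<Psi> $$ (i, r) * H r c) = 0"
    using kernel_symmetric_interpolation[of \<Psi> d E l k "\<tau> ` B" "f \<circ> \<sigma>"] \<Psi> E l kd by auto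
  define g where "g j = (case \<tau> j of (r, c) \<Rightarrow> H r c)" for j
  have "g j = f j" if "j \<in> B" for j
  proof -
    have "(case \<tau> j of (r, c) \<Rightarrow> H r c) = (f \<circ> \<sigma>) (\<tau> j)" using H(3) that by auto
    then show ?thesis using \<sigma>\<tau> that by (simp add: g_def)
  qed
  moreover have "node_content k d \<Psi> \<sigma> g i = 0\<^sub>v d" if i: "i \<in> E" for i
  proof -
    \<comment> \<open>The message matrix of \<open>g\<close> is \<open>H\<close>: symmetry covers
      the entries below the diagonal, and the lower right block is zero in both.\<close>
    have entry: "(if r < k \<or> c < k then g (\<sigma> (min r c, max r c)) else 0) = H r c"
      if "r < d" "c < d" for r c
    proof (cases "r < k \<or> c < k")
      case True
      then have "\<tau> (\<sigma> (min r c, max r c)) = (min r c, max r c)"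
        unfolding \<tau>_def using that by (intro unit_layout_inv[OF \<sigma>]) auto
      then show ?thesis using True H(1) by (auto simp: g_def min_def max_def)
    qed (use H(2) in auto)
    show ?thesis
    proof (rule eq_vecI)
      fix c assume "c < dim_vec (0\<^sub>v d :: 'a vec)"
      then have "node_content k d \<Psi> \<sigma> g i $ c = (\<Sum>r<d. \<Psi> $$ (i, r) * H r c)"
        using i E(1) entry by (subst node_content_eq[OF \<Psi>(2) kd]) auto
      then show "node_content k d \<Psi> \<sigma> g i $ c = 0\<^sub>v d $ c"
        using H(4) i \<open>c < _\<close> by simp
    qed (use i E(1) node_content_eq[OF \<Psi>(2) kd] in auto)
  qed
  ultimately show ?thesis by blast
qed

section \<open>Vanishing mutual information\<close>

text \<open>If the joint mass does not depend on the value of \<open>X\<close>, then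
  \<open>X\<close> is uniform on its range and independent of \<open>Y\<close>, so the joint mass
  factorizes.\<close>

lemma (in information_space) mutual_information_eq_0_if_uniform:
  assumes X: "simple_function M X" and Y: "simple_function M Y"
    and eq: "\<And>x x' y. x \<in> X ` space M \<Longrightarrow> x' \<in> X ` space M \<Longrightarrow>
      prob {\<omega> \<in> space M. X \<omega> = x \<and> Y \<omega> = y} = prob {\<omega> \<in> space M. X \<omega> = x' \<and> Y \<omega> = y}"
  shows "\<I>(X ; Y) = 0"
proof -
  define pX where "pX x = prob {\<omega> \<in> space M. X \<omega> = x}" for x
  define pY where "pY y = prob {\<omega> \<in> space M. Y \<omega> = y}" for y
  define pXY where "pXY z = prob {\<omega> \<in> space M. X \<omega> = fst z \<and> Y \<omega> = snd z}" for z
  have fin: "finite (X ` space M)" "finite (Y ` space M)"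
    using X Y by (auto dest: simple_functionD)
  have XY: "simple_function M (\<lambda>\<omega>. (X \<omega>, Y \<omega>))" using X Y by (rule simple_function_Pair)
  have meas: "{\<omega> \<in> space M. X \<omega> = x \<and> Y \<omega> = y} \<in> events" "{\<omega> \<in> space M. Y \<omega> = y} \<in> events"
    "{\<omega> \<in> space M. X \<omega> = x} \<in> events" for x y
    using simple_functionD(2)[OF XY, of "{(x, y)}"] simple_functionD(2)[OF Y, of "{y}"]
      simple_functionD(2)[OF X, of "{x}"]
    by (auto simp: vimage_def Int_def conj_commute)
  have dX: "simple_distributed M X pX" and dY: "simple_distributed M Y pY"
    and dXY: "simple_distributed M (\<lambda>\<omega>. (X \<omega>, Y \<omega>)) pXY"
    using X Y XY by (auto intro!: simple_distributedI arg_cong[where f = prob]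
      simp: pX_def pY_def pXY_def measure_nonneg)
  \<comment> \<open>Summing the joint mass over the \<open>N\<close> values of \<open>X\<close>
    gives \<open>pY\<close>; summing further over the values of \<open>Y\<close> gives total mass 1,
    hence \<open>N * pX x = 1\<close>.\<close>
  define N where "N = real (card (X ` space M))"
  have pY: "pY y = N * pXY (x, y)" if x: "x \<in> X ` space M" for x y
  proof -
    have "pY y = prob (\<Union>x'\<in>X ` space M. {\<omega> \<in> space M. X \<omega> = x' \<and> Y \<omega> = y})"
      unfolding pY_def by (intro arg_cong[where f = prob]) auto
    also have "\<dots> = (\<Sum>x'\<in>X ` space M. prob {\<omega> \<in> space M. X \<omega> = x' \<and> Y \<omega> = y})"
      using fin meas by (intro finite_measure_finite_Union) (auto simp: disjoint_family_on_def)
    also have "\<dots> = (\<Sum>x'\<in>X ` space M. pXY (x, y))"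
      unfolding pXY_def fst_conv snd_conv by (intro sum.cong refl eq x)
    finally show ?thesis by (simp add: N_def)
  qed
  have N: "N * pX x = 1" if x: "x \<in> X ` space M" for x
  proof -
    have "pX x = prob (\<Union>y\<in>Y ` space M. {\<omega> \<in> space M. X \<omega> = x \<and> Y \<omega> = y})"
      unfolding pX_def by (intro arg_cong[where f = prob]) auto
    also have "\<dots> = (\<Sum>y\<in>Y ` space M. pXY (x, y))"
      using fin meas unfolding pXY_def
      by (subst finite_measure_finite_Union) (auto simp: disjoint_family_on_def)
    finally have "N * pX x = (\<Sum>y\<in>Y ` space M. pY y)"
      using pY[OF x] by (simp add: sum_distrib_left)
    also have "\<dots> = prob (\<Union>y\<in>Y ` space M. {\<omega> \<in> space M. Y \<omega> = y})"
      using fin meas unfolding pY_def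
      by (subst finite_measure_finite_Union) (auto simp: disjoint_family_on_def)
    also have "(\<Union>y\<in>Y ` space M. {\<omega> \<in> space M. Y \<omega> = y}) = space M" by auto
    finally show ?thesis by (simp add: prob_space)
  qed
  have "pXY (X \<omega>, Y \<omega>) = pX (X \<omega>) * pY (Y \<omega>)" if "\<omega> \<in> space M" for \<omega>
  proof -
    have "X \<omega> \<in> X ` space M" using that by simp
    note N[OF this] pY[OF this, of "Y \<omega>"]
    then show ?thesis by (simp add: mult.assoc[symmetric] mult.commute[of _ N])
  qed
  then show ?thesis by (intro mutual_information_eq_0_simple[OF dX dY dXY]) simp
qed

section \<open>Counting events of a uniform file\<close>

lemma (in prob_space) uniform_file_prob_eq:
  fixes F :: "nat \<Rightarrow> 'a \<Rightarrow> 'q::finite"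
  assumes F: "uniform_file m F"
  shows "{\<omega> \<in> space M. \<forall>j<m. F j \<omega> = f j} \<in> events"
    and "prob {\<omega> \<in> space M. \<forall>j<m. F j \<omega> = f j} = (1 / CARD('q)) ^ m"
proof -
  have rv: "F j \<in> M \<rightarrow>\<^sub>M count_space UNIV" if "j < m" for j
    using F that unfolding uniform_file_def indep_vars_def by auto
  have p: "prob (F j -` {f j} \<inter> space M) = 1 / CARD('q)" if "j < m" for j
  proof -
    have "prob (F j -` {f j} \<inter> space M) = measure (distr M (count_space UNIV) (F j)) {f j}"
      using rv[OF that] by (simp add: measure_distr)
    also have "\<dots> = 1 / CARD('q)"
      using F that unfolding uniform_file_def by (simp add: measure_uniform_count_measure)
    finally show ?thesis .
  qed
  have ev: "F j -` {f j} \<inter> space M \<in> events" if "j < m" for j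
    using rv[OF that] by (rule measurable_sets) simp
  \<comment> \<open>For \<open>m = 0\<close> the empty intersection would be \<open>UNIV\<close>
    rather than \<open>space M\<close>, hence the separate case.\<close>
  have *: "{\<omega> \<in> space M. \<forall>j<m. F j \<omega> = f j} = (\<Inter>j\<in>{..<m}. F j -` {f j} \<inter> space M)" if "m \<noteq> 0"
    using that by auto
  show "{\<omega> \<in> space M. \<forall>j<m. F j \<omega> = f j} \<in> events"
  proof (cases "m = 0")
    case False
    then show ?thesis unfolding *[OF False] using ev by (intro sets.finite_INT) auto
  qed simp
  show "prob {\<omega> \<in> space M. \<forall>j<m. F j \<omega> = f j} = (1 / CARD('q)) ^ m"
  proof (cases "m = 0")
    case True
    then show ?thesis by (simp add: prob_space)
  next
    case False
    have "indep_vars (\<lambda>_. count_space UNIV) F {..<m}" using F unfolding uniform_file_def by simp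
    from indep_varsD[OF this, of "{..<m}" "\<lambda>j. {f j}"] show ?thesis
      unfolding *[OF False] using False p by (simp add: lessThan_empty_iff)
  qed
qed

text \<open>The event splits over the extensional functions on \<open>{..<m}\<close>. Distinct ones
  differ below \<open>m\<close>, so the pieces are disjoint, and all have equal mass.\<close>

lemma (in prob_space) uniform_file_prob:
  fixes F :: "nat \<Rightarrow> 'a \<Rightarrow> 'q::finite"
  assumes F: "uniform_file m F"
  shows "{\<omega> \<in> space M. R (\<lambda>j\<in>{..<m}. F j \<omega>)} \<in> events"
    and "prob {\<omega> \<in> space M. R (\<lambda>j\<in>{..<m}. F j \<omega>)} =
      card {f \<in> {..<m} \<rightarrow>\<^sub>E UNIV. R f} * (1 / CARD('q)) ^ m"
proof -
  let ?A = "{f \<in> {..<m} \<rightarrow>\<^sub>E UNIV. R f}"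
  let ?S = "\<lambda>f. {\<omega> \<in> space M. \<forall>j<m. F j \<omega> = f j}"
  have fin: "finite ?A" using finite_PiE[of "{..<m}" "\<lambda>_. UNIV :: 'q set"] by simp
  have mem: "R (\<lambda>j\<in>{..<m}. F j \<omega>) \<longleftrightarrow> (\<exists>f\<in>?A. \<forall>j<m. F j \<omega> = f j)" for \<omega>
  proof
    assume "R (\<lambda>j\<in>{..<m}. F j \<omega>)"
    then show "\<exists>f\<in>?A. \<forall>j<m. F j \<omega> = f j"
      by (intro bexI[of _ "\<lambda>j\<in>{..<m}. F j \<omega>"]) auto
  next
    assume "\<exists>f\<in>?A. \<forall>j<m. F j \<omega> = f j"
    then obtain f where f: "f \<in> ?A" "\<forall>j<m. F j \<omega> = f j" by blast
    then have "(\<lambda>j\<in>{..<m}. F j \<omega>) = f" by (auto simp: PiE_def extensional_def fun_eq_iff)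
    then show "R (\<lambda>j\<in>{..<m}. F j \<omega>)" using f by simp
  qed
  have *: "{\<omega> \<in> space M. R (\<lambda>j\<in>{..<m}. F j \<omega>)} = (\<Union>f\<in>?A. ?S f)"
  proof -
    have "{\<omega> \<in> space M. \<exists>f\<in>A. Q f \<omega>} = (\<Union>f\<in>A. {\<omega> \<in> space M. Q f \<omega>})"
      for A :: "(nat \<Rightarrow> 'q) set" and Q by blast
    from this[of ?A "\<lambda>f \<omega>. \<forall>j<m. F j \<omega> = f j"] show ?thesis unfolding mem .
  qed
  show "{\<omega> \<in> space M. R (\<lambda>j\<in>{..<m}. F j \<omega>)} \<in> events"
    unfolding * by (intro sets.finite_UN fin uniform_file_prob_eq(1)[OF F])
  have "disjoint_family_on ?S ?A"
    unfolding disjoint_family_on_def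
  proof (intro ballI impI)
    fix f g assume "f \<in> ?A" "g \<in> ?A" "f \<noteq> g"
    then have "\<not> (\<forall>j\<in>{..<m}. f j = g j)"
      using PiE_ext[of f "{..<m}" "\<lambda>_. UNIV" g] by blast
    then obtain j where "j < m" "f j \<noteq> g j" by blast
    then show "?S f \<inter> ?S g = {}" by auto
  qed
  then have "prob (\<Union>f\<in>?A. ?S f) = (\<Sum>f\<in>?A. prob (?S f))"
    by (intro finite_measure_finite_Union fin image_subsetI uniform_file_prob_eq(1)[OF F])
  then show "prob {\<omega> \<in> space M. R (\<lambda>j\<in>{..<m}. F j \<omega>)} =
      card ?A * (1 / CARD('q)) ^ m"
    unfolding * by (simp add: uniform_file_prob_eq(2)[OF F])
qed

text \<open>A translation that preserves \<open>\<psi>\<close> carries the files with one block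
  value injectively to those with another, so all block values are equally frequent for each
  observation.\<close>

lemma (in information_space) mutual_information_eq_0_if_translation_invariant:
  fixes F :: "nat \<Rightarrow> 'a \<Rightarrow> 'q::{finite, ab_group_add}" and \<psi> :: "(nat \<Rightarrow> 'q) \<Rightarrow> 'y"
  assumes F: "uniform_file m F" and B: "B \<subseteq> {..<m}"
    and cong: "\<And>f g. (\<And>j. j < m \<Longrightarrow> f j = g j) \<Longrightarrow> \<psi> f = \<psi> g"
    and shift: "\<And>f. \<exists>g. (\<forall>j\<in>B. g j = f j) \<and> (\<forall>h. \<psi> (\<lambda>j. h j + g j) = \<psi> h)"
  shows "\<I>(\<lambda>\<omega>. \<lambda>j\<in>B. F j \<omega> ; \<lambda>\<omega>. \<psi> (\<lambda>j. F j \<omega>)) = 0"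
proof -
  define \<Omega> where "\<Omega> = {..<m} \<rightarrow>\<^sub>E (UNIV :: 'q set)"
  \<comment> \<open>\<open>F\<close> is known to be measurable only below \<open>m\<close>;
    restricting to these indices also gives a finite range, so every function of \<open>G\<close> is
    simple.\<close>
  define G where "G \<omega> = (\<lambda>j\<in>{..<m}. F j \<omega>)" for \<omega>
  have fin: "finite \<Omega>" unfolding \<Omega>_def by (simp add: finite_PiE)
  have G: "G \<omega> \<in> \<Omega>" for \<omega> by (simp add: G_def \<Omega>_def)
  have X: "(\<lambda>j\<in>B. F j \<omega>) = restrict (G \<omega>) B" for \<omega>
    using B by (auto simp: G_def fun_eq_iff)
  have Y: "\<psi> (\<lambda>j. F j \<omega>) = \<psi> (G \<omega>)" for \<omega> by (rule cong) (simp add: G_def)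
  have simple: "simple_function M (\<lambda>\<omega>. \<phi> (G \<omega>))" for \<phi> :: "(nat \<Rightarrow> 'q) \<Rightarrow> 'z"
  proof (subst simple_function_def, intro conjI ballI)
    show "finite ((\<lambda>\<omega>. \<phi> (G \<omega>)) ` space M)"
      by (rule finite_subset[OF _ finite_imageI[OF fin, of \<phi>]]) (use G in auto)
    show "(\<lambda>\<omega>. \<phi> (G \<omega>)) -` {x} \<inter> space M \<in> events" for x
      using uniform_file_prob(1)[OF F, of "\<lambda>f. \<phi> f = x"]
      by (simp add: G_def vimage_def Int_def conj_commute)
  qed
  define N where "N \<beta> y = {h \<in> \<Omega>. restrict h B = restrict \<beta> B \<and> \<psi> h = y}" for \<beta> y
  \<comment> \<open>One inequality suffices, since \<open>\<beta>\<close> and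
    \<open>\<beta>'\<close> can be exchanged. The translation vector is chosen to equal their
    difference on \<open>B\<close>.\<close>
  have le: "card (N \<beta> y) \<le> card (N \<beta>' y)" for \<beta> \<beta>' y
  proof -
    obtain g where g: "\<And>j. j \<in> B \<Longrightarrow> g j = \<beta>' j - \<beta> j" "\<And>h. \<psi> (\<lambda>j. h j + g j) = \<psi> h"
      using shift[of "\<lambda>j. \<beta>' j - \<beta> j"] by blast
    define T where "T h = (\<lambda>j\<in>{..<m}. h j + g j)" for h
    have "inj_on T \<Omega>"
    proof (rule inj_onI)
      fix h h' assume h: "h \<in> \<Omega>" "h' \<in> \<Omega>" "T h = T h'"
      have "h j = h' j" if "j < m" for j using fun_cong[OF h(3), of j] that by (simp add: T_def)
      then show "h = h'" using h unfolding \<Omega>_def by (intro PiE_ext) auto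
    qed
    then have "inj_on T (N \<beta> y)" by (rule inj_on_subset) (auto simp: N_def)
    moreover have "T h \<in> N \<beta>' y" if h: "h \<in> N \<beta> y" for h
    proof -
      have "\<psi> (T h) = \<psi> (\<lambda>j. h j + g j)" by (rule cong) (simp add: T_def)
      moreover have "T h j = \<beta>' j" if j: "j \<in> B" for j
      proof -
        have "h j = \<beta> j" using h j unfolding N_def by (metis (mono_tags, lifting) mem_Collect_eq restrict_apply')
        then show ?thesis using g(1)[OF j] j B by (auto simp: T_def)
      qed
      ultimately show ?thesis
        using h g(2) by (auto simp: N_def \<Omega>_def T_def fun_eq_iff)
    qed
    moreover have "finite (N \<beta>' y)" using fin by (simp add: N_def)
    ultimately show ?thesis by (intro card_inj_on_le[of T]) auto
  qed
  have "\<I>(\<lambda>\<omega>. restrict (G \<omega>) B ; \<lambda>\<omega>. \<psi> (G \<omega>)) = 0"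
  proof (rule mutual_information_eq_0_if_uniform)
    fix x x' y
    assume "x \<in> (\<lambda>\<omega>. restrict (G \<omega>) B) ` space M" "x' \<in> (\<lambda>\<omega>. restrict (G \<omega>) B) ` space M"
    then obtain \<beta> \<beta>' where "x = restrict \<beta> B" "x' = restrict \<beta>' B" by blast
    moreover have "card (N \<beta> y) = card (N \<beta>' y)" using le by (intro antisym)
    moreover have "prob {\<omega> \<in> space M. restrict (G \<omega>) B = restrict \<beta> B \<and> \<psi> (G \<omega>) = y} =
        card (N \<beta> y) * (1 / CARD('q)) ^ m" for \<beta>
      using uniform_file_prob(2)[OF F, of "\<lambda>h. restrict h B = restrict \<beta> B \<and> \<psi> h = y"]
      by (simp add: G_def N_def \<Omega>_def)
    ultimately show "prob {\<omega> \<in> space M. restrict (G \<omega>) B = x \<and> \<psi> (G \<omega>) = y} =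
        prob {\<omega> \<in> space M. restrict (G \<omega>) B = x' \<and> \<psi> (G \<omega>) = y}"
      by simp
  qed (rule simple)+
  then show ?thesis by (simp only: X Y)
qed

section \<open>Block security of the product-matrix code\<close>

lemma (in information_space) product_matrix_block_secure:
  fixes \<Psi> :: "'q::{field, finite} mat" and F :: "nat \<Rightarrow> 'a \<Rightarrow> 'q"
  assumes \<Psi>: "cauchy_mat \<Psi>" "\<Psi> \<in> carrier_mat n d" and kd: "k \<le> d" and \<sigma>: "unit_layout k d \<sigma>"
    and F: "uniform_file (file_size k d) F" and l: "1 \<le> l" "l < k"
  shows "block_secure (file_size k d) n F
    (\<lambda>i \<omega>. node_content k d \<Psi> \<sigma> (\<lambda>j. F j \<omega>) i) (k - l) l"
  unfolding block_secure_def
proof (intro allI impI)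
  fix B E
  assume B: "B \<subseteq> {..<file_size k d}" "card B \<le> k - l" and E: "E \<subseteq> {..<n}" "card E \<le> l"
  show "\<I>(\<lambda>\<omega>. \<lambda>j\<in>B. F j \<omega> ; \<lambda>\<omega>. \<lambda>i\<in>E. node_content k d \<Psi> \<sigma> (\<lambda>j. F j \<omega>) i) = 0"
  proof (rule mutual_information_eq_0_if_translation_invariant[OF F B(1)])
    fix f
    \<comment> \<open>Since \<open>l < k\<close>, the subtraction in \<open>k - l\<close> is not
      truncated, and the block size is exactly what interpolation by null files allows.\<close>
    have "card B + l \<le> k" using B(2) l(2) by simp
    then obtain g where g: "\<forall>j\<in>B. g j = f j" "\<forall>i\<in>E. node_content k d \<Psi> \<sigma> g i = 0\<^sub>v d"
      using null_file_interpolation[OF \<Psi> kd \<sigma> E l(1) B(1), of f] by blast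
    have "(\<lambda>i\<in>E. node_content k d \<Psi> \<sigma> (\<lambda>j. h j + g j) i) = (\<lambda>i\<in>E. node_content k d \<Psi> \<sigma> h i)" for h
      using g(2) E(1) by (intro restrict_ext node_content_add_null[OF \<Psi>(2) kd]) auto
    then show "\<exists>g. (\<forall>j\<in>B. g j = f j) \<and> (\<forall>h. (\<lambda>i\<in>E. node_content k d \<Psi> \<sigma> (\<lambda>j. h j + g j) i) =
        (\<lambda>i\<in>E. node_content k d \<Psi> \<sigma> h i))"
      using g(1) by blast
  next
    fix f g :: "nat \<Rightarrow> 'q" assume "\<And>j. j < file_size k d \<Longrightarrow> f j = g j"
    then show "(\<lambda>i\<in>E. node_content k d \<Psi> \<sigma> f i) = (\<lambda>i\<in>E. node_content k d \<Psi> \<sigma> g i)"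
      using E(1) by (intro restrict_ext node_content_cong[OF \<Psi>(2) kd _ \<sigma>]) auto
  qed
qed

theorem theorem7:
  fixes n k d :: nat
    and \<Psi> :: "'q::{field, finite} mat"
    and \<sigma> :: "nat \<times> nat \<Rightarrow> nat"
    and P :: "'w measure"
    and base :: real
    and F :: "nat \<Rightarrow> 'w \<Rightarrow> 'q"
  assumes "1 \<le> k" and "k \<le> d" and "d \<le> n - 1"
    and "pm_encoding_mat n k d \<Psi>"
    and "cauchy_mat \<Psi>"
    and "unit_layout k d \<sigma>"
    and "information_space P base"
    and "prob_space.uniform_file P (file_size k d) F"
  shows "\<forall>l. 1 \<le> l \<and> l < k \<longrightarrow>
    information_space.block_secure P base (file_size k d) n F
      (\<lambda>i \<omega>. node_content k d \<Psi> \<sigma> (\<lambda>j. F j \<omega>) i) (k - l) l"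
proof (intro allI impI)
  fix l assume "1 \<le> l \<and> l < k"
  moreover have "\<Psi> \<in> carrier_mat n d" using assms(4) by (simp add: pm_encoding_mat_def)
  ultimately show "information_space.block_secure P base (file_size k d) n F
      (\<lambda>i \<omega>. node_content k d \<Psi> \<sigma> (\<lambda>j. F j \<omega>) i) (k - l) l"
    using assms by (intro information_space.product_matrix_block_secure) auto
qed

end
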